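(* Let $K$ be an algebraically closed field of characteristic $p>0$, let $X$ be an algebraic variety over $K$, and let $f\colon X\to X$ be a confined morphism. Then there are identities of formal power series $$\zeta_f(z)=\prod_{i\ge0}\sqrt[p^i]{\zeta^*_{f^{p^i}}(z^{p^i})}$$ and $$\zeta^*_f(z)=\zeta_f(z)\Big/\sqrt[p]{\zeta_{f^p}(z^p)}.$$
   Context: A morphism $f\colon X\to X$ is confined if for every $n\ge1$ the number $f_n$ of points of $X(K)$ fixed by the $n$-th iterate $f^n$ is finite. The (full) zeta function is $\zeta_f(z)=\exp\left(\sum_{n\ge1}f_nz^n/n\right)$ and the tame zeta function is $\zeta^*_f(z)=\exp\left(\sum_{n\ge1,\;p\nmid n}f_nz^n/n\right)$, both as formal power series. For a power series $h$ with constant term $1$, $\sqrt[m]{h}=\exp\left(\frac1m\log h\right)$ is the $m$-th root with constant term $1$. Here $f^{p^i}$ denotes the $p^i$-th iterate of $f$. *)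

theory Defs
  imports "HOL-Analysis.Analysis" "HOL-Computational_Algebra.Computational_Algebra"
    "HOL-Library.Poly_Mapping"
begin

section \<open>Affine algebraic sets\<close>

text \<open>
  A polynomial over \<open>'k\<close> is a finitely supported map from exponent vectors to coefficients.
  Points of affine \<open>n\<close>-space are extensional functions on \<open>{..<n}\<close>.
\<close>

type_synonym 'k mpoly = "(nat \<Rightarrow>\<^sub>0 nat) \<Rightarrow>\<^sub>0 'k"

definition polynomials :: "nat \<Rightarrow> 'k::field mpoly set" where
  "polynomials n = {P. \<forall>m \<in> Poly_Mapping.keys P. Poly_Mapping.keys m \<subseteq> {..<n}}"

definition mon_eval :: "(nat \<Rightarrow> 'k::field) \<Rightarrow> (nat \<Rightarrow>\<^sub>0 nat) \<Rightarrow> 'k" where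
  "mon_eval x m = (\<Prod>i\<in>Poly_Mapping.keys m. x i ^ Poly_Mapping.lookup m i)"

definition poly_eval :: "'k::field mpoly \<Rightarrow> (nat \<Rightarrow> 'k) \<Rightarrow> 'k" where
  "poly_eval P x = (\<Sum>m\<in>Poly_Mapping.keys P. Poly_Mapping.lookup P m * mon_eval x m)"

definition affine_space :: "nat \<Rightarrow> (nat \<Rightarrow> 'k::field) set" where
  "affine_space n = ({..<n} \<rightarrow>\<^sub>E UNIV)"

definition zero_locus :: "nat \<Rightarrow> 'k::field mpoly set \<Rightarrow> (nat \<Rightarrow> 'k) set" where
  "zero_locus n A = {x \<in> affine_space n. \<forall>P\<in>A. poly_eval P x = 0}"

definition algebraic_set :: "nat \<Rightarrow> (nat \<Rightarrow> 'k::field) set \<Rightarrow> bool" where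
  "algebraic_set n S \<longleftrightarrow> (\<exists>A \<subseteq> polynomials n. S = zero_locus n A)"

definition zariski :: "nat \<Rightarrow> (nat \<Rightarrow> 'k::field) topology" where
  "zariski n = topology (\<lambda>U. U \<subseteq> affine_space n \<and> algebraic_set n (affine_space n - U))"

lemma mon_eval_superset:
  assumes "finite J" "Poly_Mapping.keys m \<subseteq> J"
  shows "mon_eval x m = (\<Prod>i\<in>J. x i ^ Poly_Mapping.lookup m i)"
  unfolding mon_eval_def using assms
  by (intro prod.mono_neutral_left) (auto simp: in_keys_iff)

lemma mon_eval_add: "mon_eval x (a + b) = mon_eval x a * mon_eval x b"
proof -
  let ?J = "Poly_Mapping.keys a \<union> Poly_Mapping.keys b"
  have "Poly_Mapping.keys (a + b) \<subseteq> ?J" by (rule Poly_Mapping.keys_add)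
  then show ?thesis
    by (simp add: mon_eval_superset[of ?J] lookup_add power_add prod.distrib)
qed

lemma poly_eval_superset:
  assumes "finite J" "Poly_Mapping.keys P \<subseteq> J"
  shows "poly_eval P x = (\<Sum>m\<in>J. Poly_Mapping.lookup P m * mon_eval x m)"
  unfolding poly_eval_def using assms
  by (intro sum.mono_neutral_left) (auto simp: in_keys_iff)

lemma poly_eval_0 [simp]: "poly_eval 0 x = 0"
  by (simp add: poly_eval_def)

lemma poly_eval_single [simp]: "poly_eval (Poly_Mapping.single m c) x = c * mon_eval x m"
  by (simp add: poly_eval_def)

lemma poly_eval_1 [simp]: "poly_eval 1 x = 1"
  using poly_eval_single[of 0 1 x] by (simp add: single_one mon_eval_def del: poly_eval_single)

lemma poly_eval_add: "poly_eval (P + Q) x = poly_eval P x + poly_eval Q x"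
proof -
  let ?J = "Poly_Mapping.keys P \<union> Poly_Mapping.keys Q"
  have "Poly_Mapping.keys (P + Q) \<subseteq> ?J" by (rule Poly_Mapping.keys_add)
  then show ?thesis
    by (simp add: poly_eval_superset[of ?J] lookup_add distrib_right sum.distrib)
qed

lemma poly_eval_sum: "poly_eval (\<Sum>i\<in>I. P i) x = (\<Sum>i\<in>I. poly_eval (P i) x)"
  by (induction I rule: infinite_finite_induct) (auto simp: poly_eval_add)

lemma mpoly_eq_sum_single: "P = (\<Sum>m\<in>Poly_Mapping.keys P. Poly_Mapping.single m (Poly_Mapping.lookup P m))"
  for P :: "'k::field mpoly"
proof (rule poly_mapping_eqI)
  fix k
  show "Poly_Mapping.lookup P k = Poly_Mapping.lookup (\<Sum>m\<in>Poly_Mapping.keys P. Poly_Mapping.single m (Poly_Mapping.lookup P m)) k"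
    by (simp add: lookup_sum lookup_single when_def in_keys_iff)
qed

lemma poly_eval_mult: "poly_eval (P * Q) x = poly_eval P x * poly_eval Q x"
proof -
  have "P * Q = (\<Sum>m\<in>Poly_Mapping.keys P. \<Sum>m'\<in>Poly_Mapping.keys Q.
      Poly_Mapping.single (m + m') (Poly_Mapping.lookup P m * Poly_Mapping.lookup Q m'))"
    by (subst mpoly_eq_sum_single[of P], subst mpoly_eq_sum_single[of Q])
      (simp add: sum_product mult_single)
  then have "poly_eval (P * Q) x = (\<Sum>m\<in>Poly_Mapping.keys P. \<Sum>m'\<in>Poly_Mapping.keys Q.
      (Poly_Mapping.lookup P m * Poly_Mapping.lookup Q m') * (mon_eval x m * mon_eval x m'))"
    by (simp only: poly_eval_sum poly_eval_single mon_eval_add)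
  then show ?thesis
    by (simp add: poly_eval_def sum_product mult_ac)
qed

lemma polynomials_mult:
  assumes "P \<in> polynomials n" "Q \<in> polynomials n"
  shows "P * Q \<in> polynomials n"
proof -
  have "Poly_Mapping.keys m \<subseteq> {..<n}" if m: "m \<in> Poly_Mapping.keys (P * Q)" for m
  proof -
    obtain a b where "a \<in> Poly_Mapping.keys P" "b \<in> Poly_Mapping.keys Q" "m = a + b"
      using m keys_mult[of P Q] by blast
    then show ?thesis
      using assms Poly_Mapping.keys_add[of a b] unfolding polynomials_def by blast
  qed
  then show ?thesis by (auto simp: polynomials_def)
qed

lemma algebraic_set_Un:
  assumes "algebraic_set n S" "algebraic_set n T"
  shows "algebraic_set n (S \<union> T)"
proof -
  obtain A B where A: "A \<subseteq> polynomials n" "S = zero_locus n A"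
    and B: "B \<subseteq> polynomials n" "T = zero_locus n B"
    using assms by (auto simp: algebraic_set_def)
  let ?C = "(\<lambda>(P, Q). P * Q) ` (A \<times> B)"
  have "?C \<subseteq> polynomials n"
    using A B by (auto intro!: polynomials_mult)
  moreover have "S \<union> T = zero_locus n ?C"
    unfolding A(2) B(2) zero_locus_def by (auto simp: poly_eval_mult)
  ultimately show ?thesis unfolding algebraic_set_def by blast
qed

lemma algebraic_set_affine_space: "algebraic_set n (affine_space n)"
  unfolding algebraic_set_def by (rule exI[of _ "{}"]) (simp add: zero_locus_def)

lemma algebraic_set_Inter:
  assumes "\<And>S. S \<in> \<S> \<Longrightarrow> algebraic_set n S"
  shows "algebraic_set n (affine_space n \<inter> \<Inter>\<S>)"
proof -
  obtain A where A: "\<And>S. S \<in> \<S> \<Longrightarrow> A S \<subseteq> polynomials n \<and> S = zero_locus n (A S)"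
    using assms unfolding algebraic_set_def by metis
  have "affine_space n \<inter> \<Inter>\<S> = zero_locus n (\<Union>S\<in>\<S>. A S)" (is "?L = ?R")
  proof (rule set_eqI)
    fix x
    have "x \<in> ?L \<longleftrightarrow> x \<in> affine_space n \<and> (\<forall>S\<in>\<S>. x \<in> zero_locus n (A S))"
      using A by auto
    also have "\<dots> \<longleftrightarrow> x \<in> ?R"
      by (auto simp: zero_locus_def)
    finally show "x \<in> ?L \<longleftrightarrow> x \<in> ?R" .
  qed
  moreover have "(\<Union>S\<in>\<S>. A S) \<subseteq> polynomials n" using A by blast
  ultimately show ?thesis unfolding algebraic_set_def by blast
qed

lemma openin_zariski:
  "openin (zariski n) U \<longleftrightarrow> U \<subseteq> affine_space n \<and> algebraic_set n (affine_space n - U)"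
proof -
  have "istopology (\<lambda>U. U \<subseteq> affine_space n \<and> algebraic_set n (affine_space n - U :: (nat \<Rightarrow> 'a) set))"
    unfolding istopology_def
  proof (intro conjI allI impI, goal_cases)
    case (2 S T)
    then show ?case using algebraic_set_Un by (metis Diff_Int)
  next
    case (4 \<K>)
    have "algebraic_set n (affine_space n \<inter> \<Inter>((\<lambda>U. affine_space n - U) ` \<K>))"
      using 4 by (intro algebraic_set_Inter) auto
    moreover have "affine_space n \<inter> \<Inter>((\<lambda>U. affine_space n - U) ` \<K>)
        = affine_space n - \<Union>\<K>" by auto
    ultimately show ?case by simp
  qed auto
  then show ?thesis unfolding zariski_def by (simp add: topology_inverse')
qed

lemma topspace_zariski [simp]: "topspace (zariski n) = affine_space n"
proof -
  have "zero_locus n {1::'a mpoly} = {}" by (simp add: zero_locus_def)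
  moreover have "{1::'a mpoly} \<subseteq> polynomials n"
    by (auto simp: polynomials_def simp flip: single_one split: if_splits)
  ultimately have "algebraic_set n ({} :: (nat \<Rightarrow> 'a) set)"
    unfolding algebraic_set_def by metis
  then have "openin (zariski n) (affine_space n :: (nat \<Rightarrow> 'a) set)"
    by (simp add: openin_zariski)
  then show ?thesis
    by (meson openin_subset openin_topspace openin_zariski subset_antisym)
qed

lemma closedin_zariski: "closedin (zariski n) S \<longleftrightarrow> algebraic_set n S"
proof -
  have "S \<subseteq> affine_space n" if "algebraic_set n S"
    using that by (auto simp: algebraic_set_def zero_locus_def)
  then show ?thesis
    by (auto simp: closedin_def openin_zariski double_diff)
qed


section \<open>Algebraic varieties\<close>

text \<open>
  Over an algebraically closed field \<open>K\<close>, varieties are treated in the language of Serre's FAC: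
  a variety is a topological space, whose points are the \<open>K\<close>-points, with a sheaf of
  \<open>K\<close>-valued functions that is locally that of an affine algebraic set.
  A function on an open set \<open>U\<close> is represented by its extension by \<open>undefined\<close> outside \<open>U\<close>;
  the values of \<open>regular\<close> on sets that are not open are irrelevant.
\<close>

record ('x, 'k) function_space =
  top_of :: "'x topology"
  regular :: "'x set \<Rightarrow> ('x \<Rightarrow> 'k) set"

definition points :: "('x, 'k) function_space \<Rightarrow> 'x set" where
  "points X = topspace (top_of X)"

definition is_function_space :: "('x, 'k::field) function_space \<Rightarrow> bool" where
  "is_function_space X \<longleftrightarrow>
    (\<forall>U. openin (top_of X) U \<longrightarrow>
      regular X U \<subseteq> extensional U \<and>
      (\<forall>c. restrict (\<lambda>_. c) U \<in> regular X U) \<and>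
      (\<forall>g \<in> regular X U. \<forall>h \<in> regular X U.
        restrict (\<lambda>x. g x + h x) U \<in> regular X U \<and>
        restrict (\<lambda>x. g x * h x) U \<in> regular X U) \<and>
      (\<forall>V. openin (top_of X) V \<and> V \<subseteq> U \<longrightarrow>
        (\<forall>g \<in> regular X U. restrict g V \<in> regular X V)) \<and>
      (\<forall>g \<in> extensional U.
        (\<forall>x\<in>U. \<exists>V. openin (top_of X) V \<and> x \<in> V \<and> V \<subseteq> U \<and> restrict g V \<in> regular X V)
        \<longrightarrow> g \<in> regular X U))"

definition morphism ::
    "('x, 'k::field) function_space \<Rightarrow> ('y, 'k) function_space \<Rightarrow> ('x \<Rightarrow> 'y) \<Rightarrow> bool" where
  "morphism X Y f \<longleftrightarrow>
    continuous_map (top_of X) (top_of Y) f \<and>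
    (\<forall>V. openin (top_of Y) V \<longrightarrow> (\<forall>g \<in> regular Y V.
      restrict (g \<circ> f) {x \<in> points X. f x \<in> V} \<in> regular X {x \<in> points X. f x \<in> V}))"

definition isomorphic ::
    "('x, 'k::field) function_space \<Rightarrow> ('y, 'k) function_space \<Rightarrow> bool" where
  "isomorphic X Y \<longleftrightarrow>
    (\<exists>f g. morphism X Y f \<and> morphism Y X g \<and>
      (\<forall>x \<in> points X. g (f x) = x) \<and> (\<forall>y \<in> points Y. f (g y) = y))"

definition open_subspace ::
    "('x, 'k) function_space \<Rightarrow> 'x set \<Rightarrow> ('x, 'k) function_space" where
  "open_subspace X U = \<lparr>top_of = subtopology (top_of X) U, regular = regular X\<rparr>"

definition algebraic_set_space ::
    "nat \<Rightarrow> (nat \<Rightarrow> 'k::field) set \<Rightarrow> (nat \<Rightarrow> 'k, 'k) function_space" where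
  "algebraic_set_space n S =
    \<lparr>top_of = subtopology (zariski n) S,
     regular = (\<lambda>U. {g \<in> extensional U. \<forall>x\<in>U. \<exists>V P Q.
       openin (subtopology (zariski n) S) V \<and> x \<in> V \<and> V \<subseteq> U \<and>
       P \<in> polynomials n \<and> Q \<in> polynomials n \<and>
       (\<forall>y\<in>V. poly_eval Q y \<noteq> 0 \<and> g y = poly_eval P y / poly_eval Q y)})\<rparr>"

definition is_affine :: "('x, 'k::field) function_space \<Rightarrow> bool" where
  "is_affine X \<longleftrightarrow> (\<exists>n S. algebraic_set n S \<and> isomorphic X (algebraic_set_space n S))"

definition prevariety :: "('x, 'k::field) function_space \<Rightarrow> bool" where
  "prevariety X \<longleftrightarrow> is_function_space X \<and>
    (\<exists>\<U>. finite \<U> \<and> \<Union>\<U> = points X \<and>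
      (\<forall>U\<in>\<U>. openin (top_of X) U \<and> is_affine (open_subspace X U)))"

text \<open>
  Separatedness is formulated via equalisers of morphisms from affine varieties, as in Milne's
  Algebraic Geometry; for prevarieties this is closedness of the diagonal.
\<close>

definition separated :: "('x, 'k::field) function_space \<Rightarrow> bool" where
  "separated X \<longleftrightarrow>
    (\<forall>n S f g. algebraic_set n S \<and>
       morphism (algebraic_set_space n S) X f \<and> morphism (algebraic_set_space n S) X g
       \<longrightarrow> closedin (zariski n) {y \<in> S. f y = g y})"

text \<open>Irreducibility is not required.\<close>

definition algebraic_variety :: "('x, 'k::alg_closed_field) function_space \<Rightarrow> bool" where
  "algebraic_variety X \<longleftrightarrow> prevariety X \<and> separated X"


section \<open>Zeta functions\<close>

definition fixed_points :: "('x, 'k) function_space \<Rightarrow> ('x \<Rightarrow> 'x) \<Rightarrow> nat \<Rightarrow> 'x set" where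
  "fixed_points X f n = {x \<in> points X. (f ^^ n) x = x}"

definition confined :: "('x, 'k) function_space \<Rightarrow> ('x \<Rightarrow> 'x) \<Rightarrow> bool" where
  "confined X f \<longleftrightarrow> (\<forall>n\<ge>1. finite (fixed_points X f n))"

definition zeta :: "('x, 'k) function_space \<Rightarrow> ('x \<Rightarrow> 'x) \<Rightarrow> rat fps" where
  "zeta X f = fps_exp 1 oo
    Abs_fps (\<lambda>n. if n \<ge> 1 then of_nat (card (fixed_points X f n)) / of_nat n else 0)"

definition tame_zeta :: "nat \<Rightarrow> ('x, 'k) function_space \<Rightarrow> ('x \<Rightarrow> 'x) \<Rightarrow> rat fps" where
  "tame_zeta p X f = fps_exp 1 oo
    Abs_fps (\<lambda>n. if n \<ge> 1 \<and> \<not> p dvd n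
      then of_nat (card (fixed_points X f n)) / of_nat n else 0)"

text \<open>\<open>fps_ln 1\<close> is the series of \<open>log (1 + z)\<close>; both definitions are meant for constant term 1.\<close>

definition fps_log :: "rat fps \<Rightarrow> rat fps" where
  "fps_log h = fps_ln 1 oo (h - 1)"

definition fps_nth_root :: "nat \<Rightarrow> rat fps \<Rightarrow> rat fps" where
  "fps_nth_root m h = fps_exp 1 oo (fps_const (1 / of_nat m) * fps_log h)"

end

theory Submission
  imports Defs
begin

text \<open>
  Both identities come from a partition of the positive integers, pushed through the exponential.
  For a set \<open>S\<close> of indices let \<open>zeta_on X f S\<close> be the exponential of the sum of
  \<open>f\<^sub>n z\<^sup>n / n\<close> over positive \<open>n \<in> S\<close>; the full and the tame zeta functions are the cases
  where \<open>S\<close> is everything and where \<open>S\<close> consists of the integers prime to \<open>p\<close>.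

  A disjoint union of index sets corresponds to a product of series (\<open>zeta_on_Un\<close>). Replacing
  \<open>f\<close> by \<open>f ^^ q\<close> and \<open>z\<close> by \<open>z\<^sup>q\<close> and taking the \<open>q\<close>-th root corresponds to replacing
  \<open>S\<close> by \<open>q S\<close> (\<open>nth_root_zeta_on_iterate\<close>), because for \<open>m = q n\<close> the number of fixed points
  of \<open>(f ^^ q) ^^ n\<close> is \<open>f\<^sub>m\<close> and \<open>(1 / q) * (1 / n) = 1 / m\<close>.

  The product formula is then the partition of the positive integers by the exact power of \<open>p\<close>
  dividing them, and the quotient formula is their division into multiples and non-multiples
  of \<open>p\<close>. The first partition has infinitely many blocks, but a positive integer up to \<open>k\<close> lies in
  one of the first \<open>k + 1\<close> of them, so every coefficient of the partial products is eventually
  constant.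
\<close>

text \<open>
  An exponential is characterised by its differential equation: multiplying a solution by the
  exponential of \<open>-b\<close> gives a series with zero derivative.
\<close>

lemma fps_exp_compose_unique:
  fixes b F :: "'a::field_char_0 fps"
  assumes b0: "b $ 0 = 0" and F0: "F $ 0 = 1" and dF: "fps_deriv F = fps_deriv b * F"
  shows "F = fps_exp 1 oo b"
proof -
  have dexp: "fps_deriv (fps_exp 1 oo c) = fps_deriv c * (fps_exp 1 oo c)"
    if "c $ 0 = 0" for c :: "'a fps"
    using that by (simp add: fps_compose_deriv)
  define G where "G = fps_exp 1 oo (- b)"
  have G0: "G $ 0 = 1" by (simp add: G_def)
  have dG: "fps_deriv G = - fps_deriv b * G"
    unfolding G_def using dexp[of "- b"] b0 by simp
  have inv: "H * G = 1" if "H $ 0 = 1" "fps_deriv H = fps_deriv b * H" for H :: "'a fps"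
  proof -
    have "fps_deriv (H * G) = 0"
      by (simp add: that dG algebra_simps)
    then have "H * G = fps_const ((H * G) $ 0)"
      by (simp only: fps_deriv_eq_0_iff)
    then show ?thesis
      using that(1) G0 by simp
  qed
  have "F * G = 1" using inv F0 dF by blast
  moreover have "(fps_exp 1 oo b) * G = 1" using inv[of "fps_exp 1 oo b"] dexp[OF b0] by simp
  moreover have "G \<noteq> 0" using G0 by auto
  ultimately show ?thesis by (metis mult_right_cancel)
qed

lemma fps_exp_compose_add:
  fixes b c :: "'a::field_char_0 fps"
  assumes "b $ 0 = 0" "c $ 0 = 0"
  shows "fps_exp 1 oo (b + c) = (fps_exp 1 oo b) * (fps_exp 1 oo c)"
  using assms
  by (intro fps_exp_compose_unique[symmetric]) (simp_all add: fps_compose_deriv algebra_simps)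

lemma fps_log_exp_compose:
  fixes b :: "rat fps"
  assumes "b $ 0 = 0"
  shows "fps_log (fps_exp 1 oo b) = b"
proof -
  have "fps_log (fps_exp 1 oo b) = fps_ln 1 oo ((fps_exp 1 - 1) oo b)"
    by (simp add: fps_log_def fps_compose_sub_distrib)
  also have "\<dots> = (fps_ln 1 oo (fps_exp 1 - 1)) oo b"
    using assms by (intro fps_compose_assoc) simp_all
  also have "fps_ln 1 oo (fps_exp 1 - 1) = (fps_X :: rat fps)"
    by (simp add: fps_ln_fps_exp_inv fps_inv_fps_exp_compose)
  finally show ?thesis using assms by simp
qed

lemma fps_nth_root_exp_compose:
  fixes b :: "rat fps"
  assumes "b $ 0 = 0"
  shows "fps_nth_root m (fps_exp 1 oo b) = fps_exp 1 oo (fps_const (1 / of_nat m) * b)"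
  using assms by (simp add: fps_nth_root_def fps_log_exp_compose)

text \<open>
  This locality of composition replaces continuity of the exponential when passing to the limit.
\<close>

lemma fps_compose_nth_cong:
  fixes a b c :: "'a::comm_ring_1 fps"
  assumes "\<And>j. j \<le> k \<Longrightarrow> b $ j = c $ j"
  shows "(a oo b) $ k = (a oo c) $ k"
proof -
  have "j \<le> k \<Longrightarrow> b ^ i $ j = c ^ i $ j" for i j
    by (induction i arbitrary: j) (auto simp: fps_mult_nth assms intro!: sum.cong)
  then show ?thesis by (simp add: fps_compose_nth)
qed

definition log_zeta_on :: "('x, 'k) function_space \<Rightarrow> ('x \<Rightarrow> 'x) \<Rightarrow> nat set \<Rightarrow> rat fps" where
  "log_zeta_on X f S = Abs_fps (\<lambda>n. if n \<ge> 1 \<and> n \<in> S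
     then of_nat (card (fixed_points X f n)) / of_nat n else 0)"

definition zeta_on :: "('x, 'k) function_space \<Rightarrow> ('x \<Rightarrow> 'x) \<Rightarrow> nat set \<Rightarrow> rat fps" where
  "zeta_on X f S = fps_exp 1 oo log_zeta_on X f S"

lemma log_zeta_on_nth_0 [simp]: "log_zeta_on X f S $ 0 = 0"
  by (simp add: log_zeta_on_def)

lemma zeta_on_nonzero: "zeta_on X f S \<noteq> 0"
proof
  assume "zeta_on X f S = 0"
  then have "zeta_on X f S $ 0 = 0" by simp
  then show False by (simp add: zeta_on_def)
qed

lemma zeta_eq_zeta_on: "zeta X f = zeta_on X f UNIV"
  by (simp add: zeta_def zeta_on_def log_zeta_on_def)

lemma tame_zeta_eq_zeta_on: "tame_zeta p X f = zeta_on X f {n. \<not> p dvd n}"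
  by (simp add: tame_zeta_def zeta_on_def log_zeta_on_def)

lemma zeta_on_Un:
  assumes "S \<inter> T = {}"
  shows "zeta_on X f (S \<union> T) = zeta_on X f S * zeta_on X f T"
proof -
  have "log_zeta_on X f (S \<union> T) = log_zeta_on X f S + log_zeta_on X f T"
    using assms by (auto simp: log_zeta_on_def fps_eq_iff)
  then show ?thesis by (simp add: zeta_on_def fps_exp_compose_add)
qed

lemma fixed_points_iterate: "fixed_points X (f ^^ q) n = fixed_points X f (q * n)"
  by (simp add: fixed_points_def funpow_mult mult.commute)

lemma log_zeta_on_iterate:
  assumes "q > 0"
  shows "fps_const (1 / of_nat q) * (log_zeta_on X (f ^^ q) S oo fps_X ^ q)
    = log_zeta_on X f ((*) q ` S)"
proof (rule fps_ext)
  fix m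
  show "(fps_const (1 / of_nat q) * (log_zeta_on X (f ^^ q) S oo fps_X ^ q)) $ m
    = log_zeta_on X f ((*) q ` S) $ m"
  proof (cases "q dvd m")
    case True
    then obtain n where m: "m = q * n" by blast
    show ?thesis
      using assms
      by (auto simp: m log_zeta_on_def fps_nth_compose_X_power fixed_points_iterate)
  next
    case False
    then show ?thesis
      using assms by (auto simp: log_zeta_on_def fps_nth_compose_X_power)
  qed
qed

lemma nth_root_zeta_on_iterate:
  assumes "q > 0"
  shows "fps_nth_root q (zeta_on X (f ^^ q) S oo fps_X ^ q) = zeta_on X f ((*) q ` S)"
proof -
  have "zeta_on X (f ^^ q) S oo fps_X ^ q
      = fps_exp 1 oo (log_zeta_on X (f ^^ q) S oo fps_X ^ q)"
    unfolding zeta_on_def using assms by (intro fps_compose_assoc[symmetric]) auto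
  then show ?thesis
    using assms by (simp add: fps_nth_root_exp_compose log_zeta_on_iterate zeta_on_def)
qed

lemma non_multiples_power_Suc:
  fixes p :: nat
  assumes "p > 0"
  shows "{m. \<not> p ^ Suc i dvd m} = {m. \<not> p ^ i dvd m} \<union> (*) (p ^ i) ` {n. \<not> p dvd n}"
proof -
  have "p ^ Suc i dvd p ^ i * n \<longleftrightarrow> p dvd n" for n
    using assms by (simp add: mult.commute)
  then show ?thesis
    by (auto elim!: dvdE dest: dvd_mult_left simp: mult.commute intro: dvd_trans)
qed

lemma prod_zeta_on_power:
  assumes "p > 0"
  shows "(\<Prod>i<k. zeta_on X f ((*) (p ^ i) ` {n. \<not> p dvd n})) = zeta_on X f {m. \<not> p ^ k dvd m}"
proof (induction k)
  case 0
  have "log_zeta_on X f {} = 0" by (simp add: log_zeta_on_def fps_eq_iff)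
  then show ?case by (simp add: zeta_on_def)
next
  case (Suc k)
  have "{m. \<not> p ^ k dvd m} \<inter> (*) (p ^ k) ` {n. \<not> p dvd n} = {}" by auto
  then show ?case
    by (simp only: prod.lessThan_Suc Suc non_multiples_power_Suc[OF assms] zeta_on_Un)
qed

text \<open>
  A positive integer up to \<open>j\<close> is smaller than \<open>p ^ k\<close> once \<open>k > j\<close>, so it is not a multiple
  of \<open>p ^ k\<close>, and the coefficient of index \<open>j\<close> has reached its final value.
\<close>

lemma zeta_on_non_multiples_tendsto:
  assumes "p > 1"
  shows "(\<lambda>k. zeta_on X f {m. \<not> p ^ k dvd m}) \<longlonglongrightarrow> zeta_on X f UNIV"
proof (rule tendsto_fpsI)
  fix j
  have "zeta_on X f {m. \<not> p ^ k dvd m} $ j = zeta_on X f UNIV $ j" if "k > j" for k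
    unfolding zeta_on_def
  proof (rule fps_compose_nth_cong)
    fix n assume "n \<le> j"
    then have "n < p ^ k"
      using that power_gt_expt[of p k] assms by linarith
    then show "log_zeta_on X f {m. \<not> p ^ k dvd m} $ n = log_zeta_on X f UNIV $ n"
      by (auto simp: log_zeta_on_def dest: dvd_imp_le)
  qed
  then show "\<forall>\<^sub>F k in sequentially. zeta_on X f {m. \<not> p ^ k dvd m} $ j = zeta_on X f UNIV $ j"
    using eventually_gt_at_top[of j] by (rule eventually_mono[rotated])
qed

theorem proposition7p2:
  fixes X :: "('x, 'k::alg_closed_field) function_space"
    and f :: "'x \<Rightarrow> 'x"
    and p :: nat
  assumes "CHAR('k) = p" and "p > 0"
    and "algebraic_variety X"
    and "morphism X X f"
    and "confined X f"
  shows "((\<lambda>i. fps_nth_root (p ^ i) (tame_zeta p X (f ^^ (p ^ i)) oo fps_X ^ (p ^ i)))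
           has_prod zeta X f)
         \<and> tame_zeta p X f = zeta X f / fps_nth_root p (zeta X (f ^^ p) oo fps_X ^ p)"
proof
  have "p \<noteq> 1" using assms(1) CHAR_not_1'[where 'a='k] by simp
  then have p: "p > 1" using assms(2) by linarith
  have factor: "fps_nth_root (p ^ i) (tame_zeta p X (f ^^ (p ^ i)) oo fps_X ^ (p ^ i))
      = zeta_on X f ((*) (p ^ i) ` {n. \<not> p dvd n})" for i
    using assms(2) by (simp add: tame_zeta_eq_zeta_on nth_root_zeta_on_iterate)
  have "(\<lambda>n. \<Prod>i\<le>n. zeta_on X f ((*) (p ^ i) ` {n. \<not> p dvd n})) \<longlonglongrightarrow> zeta_on X f UNIV"
    using LIMSEQ_Suc[OF zeta_on_non_multiples_tendsto[OF p, of X f]]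
    by (simp only: prod_zeta_on_power[OF assms(2), symmetric] lessThan_Suc_atMost)
  then show "(\<lambda>i. fps_nth_root (p ^ i) (tame_zeta p X (f ^^ (p ^ i)) oo fps_X ^ (p ^ i)))
      has_prod zeta X f"
    by (simp add: factor has_prod_def raw_has_prod_def zeta_eq_zeta_on zeta_on_nonzero)
next
  have "UNIV = {n. \<not> p dvd n} \<union> range ((*) p)" by (auto elim: dvdE)
  moreover have "{n. \<not> p dvd n} \<inter> range ((*) p) = {}" by auto
  ultimately have "zeta X f = tame_zeta p X f * zeta_on X f (range ((*) p))"
    by (metis zeta_on_Un zeta_eq_zeta_on tame_zeta_eq_zeta_on)
  moreover have "fps_nth_root p (zeta X (f ^^ p) oo fps_X ^ p) = zeta_on X f (range ((*) p))"
    using assms(2) by (simp add: zeta_eq_zeta_on nth_root_zeta_on_iterate)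
  ultimately show "tame_zeta p X f = zeta X f / fps_nth_root p (zeta X (f ^^ p) oo fps_X ^ p)"
    by (simp add: zeta_on_nonzero)
qed

end
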